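(* Let $K$ be a Hausdorff, patch-compact subset of a stably compact, second-countable space $X$, and let $\mu$ be a non-zero, bounded measure on $X$ supported on $K$ (i.e. $K$ is a support of $\mu$). Then $\mu$ is $\tau$-smooth, and $\widetilde\mu$ is the largest continuous $\mathbf I\mathbb R_+^\star$-valuation on $X$ (for the pointwise ordering) that approximates $\mu$.
   Context: $\overline{\mathbb R}_+=[0,+\infty]$. $\mathbf I\mathbb R_+^\star$ is the dcpo of closed intervals $[a,b]$ with $0\le a\le b\le+\infty$, ordered by reverse inclusion, with its Scott topology. It carries $0=[0,0]$, $1=[1,1]$, $[a,b]+[c,d]=[a+c,b+d]$, $[a,b]\times[c,d]=[a\cdot_\ell c,\ b\cdot_r d]$, where $\cdot_\ell$ and $\cdot_r$ are the usual product except that $0\cdot_\ell(+\infty)=(+\infty)\cdot_\ell 0=0$ and $0\cdot_r(+\infty)=(+\infty)\cdot_r 0=+\infty$. For a topological space $X$, $\mathcal L^{\mathbf I\mathbb R_+^\star}X$ is the dcpo of continuous maps $h:X\to\mathbf I\mathbb R_+^\star$, ordered pointwise, with pointwise $+$ and $\times$; write $h(x)=[h^-(x),h^+(x)]$; then $h^-$ is lower semicontinuous and $h^+$ is upper semicontinuous. A continuous $\mathbf I\mathbb R_+^\star$-valuation on $X$ is a Scott-continuous map $\nu:\mathcal L^{\mathbf I\mathbb R_+^\star}X\to\mathbf I\mathbb R_+^\star$ with $\nu(\mathbf a\times h)=\mathbf a\times\nu(h)$ and $\nu(h+h')=\nu(h)+\nu(h')$ for all $\mathbf a\in\mathbf I\mathbb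 R_+^\star$ and all $h,h'$. These are ordered pointwise. Measures on $X$ are $\overline{\mathbb R}_+$-valued measures on the Borel $\sigma$-algebra. $\mu$ is bounded if $\mu(X)<\infty$, non-zero if $\mu(X)\ne 0$, $\tau$-smooth if $\mu(\bigcup_i U_i)=\sup_i\mu(U_i)$ for every directed family of open sets. A support of $\mu$ is a set $E\subseteq X$ such that for all measurable $A,B$ with $A\cap E=B\cap E$, $\mu(A)=\mu(B)$; $\mu$ is supported on $E$ if $E$ is a support of $\mu$. For $\tau$-smooth $\mu$, $\operatorname{supp}\mu$ is the smallest closed support of $\mu$. Lower integral of a measurable $f:X\to\overline{\mathbb R}_+$: $\int_{x\in X}^- f(x)\,d\mu=\sup_{r\in\mathbb R_+}\int_{x\in X}\min(f(x),r)\,d\mu$. For $\tau$-smooth $\mu$, a measurable $f$ is $\mu$-bounded if there is a measurable compact saturated support $Q$ of $\mu$ with $\sup_{x\in Q\cap\operatorname{supp}\mu}f(x)<\infty$. For upper semicontinuous $f:X\to\overline{\mathbb R}_+$, the upper integral $\int_{x\in X}^+ f(x)\,d\mu$ is $\int_{x\in X}^- f(x)\,d\mu$ if $f$ is $\mu$-bounded, and $\infty$ otherwise. For $\tau$-smooth $\mu$, $\widetilde\mu(h)=\left[\int_{x\in X}^- h^-(x)\,d\mu,\ \int_{x\in X}^+ h^+(x)\,d\mu\right]$ for $h\in\mathcal L^{\mathbf I\mathbb R_+^\star}X$. An interval $[a,b]$ approximates $x$ if $a\le x\le b$. A map $h\in\mathcal L^{\mathbf I\mathbb R_+^\star}X$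 approximates a measurable $f:X\to\overline{\mathbb R}_+$ if $h(x)$ approximates $f(x)$ for every $x\in X$. A continuous $\mathbf I\mathbb R_+^\star$-valuation $\nu$ approximates a measure $\mu$ if for every measurable $f:X\to\overline{\mathbb R}_+$ and every $h\in\mathcal L^{\mathbf I\mathbb R_+^\star}X$ approximating $f$, $\nu(h)$ approximates $\int_{x\in X}^- f(x)\,d\mu$. A set is saturated if it is an intersection of open sets. A space is stably compact if it is sober, locally compact, compact, and coherent (the intersection of any two compact saturated sets is compact). The patch topology on $X$ is the coarsest topology containing the open subsets of $X$ and the complements of compact saturated subsets; patch-compact means compact in the patch topology. A subset $K$ is Hausdorff if it is Hausdorff in the subspace topology inherited from $X$. *)

theory Defs
  imports "HOL-Analysis.Analysis"
begin

definition directed_family :: "'p::order set \<Rightarrow> bool" where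
  "directed_family D \<longleftrightarrow> D \<noteq> {} \<and> (\<forall>x\<in>D. \<forall>y\<in>D. \<exists>z\<in>D. x \<le> z \<and> y \<le> z)"

definition is_sup_in :: "'p::order set \<Rightarrow> 'p set \<Rightarrow> 'p \<Rightarrow> bool" where
  "is_sup_in A D s \<longleftrightarrow>
     s \<in> A \<and> (\<forall>d\<in>D. d \<le> s) \<and> (\<forall>u\<in>A. (\<forall>d\<in>D. d \<le> u) \<longrightarrow> s \<le> u)"

definition scott_open :: "'p::order set \<Rightarrow> bool" where
  "scott_open U \<longleftrightarrow>
     (\<forall>x y. x \<in> U \<and> x \<le> y \<longrightarrow> y \<in> U) \<and>
     (\<forall>D s. directed_family D \<and> is_sup_in UNIV D s \<and> s \<in> U \<longrightarrow> D \<inter> U \<noteq> {})"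

text \<open>Directed suprema are taken inside the sub-poset \<open>A\<close>.\<close>
definition scott_continuous_on :: "'p::order set \<Rightarrow> ('p \<Rightarrow> 'q::order) \<Rightarrow> bool" where
  "scott_continuous_on A f \<longleftrightarrow>
     mono_on A f \<and>
     (\<forall>D s. D \<subseteq> A \<and> directed_family D \<and> is_sup_in A D s \<longrightarrow> is_sup_in UNIV (f ` D) (f s))"

text \<open>The library type of intervals is not used: it is ordered by inclusion, and its
  topology and multiplication are different.\<close>

typedef ival = "{(a :: ennreal, b :: ennreal). a \<le> b}"
  by auto

setup_lifting type_definition_ival

lift_definition lo :: "ival \<Rightarrow> ennreal" is fst .
lift_definition hi :: "ival \<Rightarrow> ennreal" is snd .

text \<open>Meaningful only if \<open>a \<le> b\<close>.\<close>
definition mk_ival :: "ennreal \<Rightarrow> ennreal \<Rightarrow> ival" where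
  "mk_ival a b = Abs_ival (a, b)"

lemma lo_le_hi: "lo x \<le> hi x"
  by transfer auto

lemma ival_eq_iff: "x = y \<longleftrightarrow> lo x = lo y \<and> hi x = hi y"
  by transfer (auto simp: prod_eq_iff)

lemma lo_mk_ival [simp]: "a \<le> b \<Longrightarrow> lo (mk_ival a b) = a"
  by (simp add: mk_ival_def lo.rep_eq Abs_ival_inverse)

lemma hi_mk_ival [simp]: "a \<le> b \<Longrightarrow> hi (mk_ival a b) = b"
  by (simp add: mk_ival_def hi.rep_eq Abs_ival_inverse)

instantiation ival :: order
begin

definition less_eq_ival :: "ival \<Rightarrow> ival \<Rightarrow> bool" where
  "x \<le> y \<longleftrightarrow> {lo y..hi y} \<subseteq> {lo x..hi x}"

definition less_ival :: "ival \<Rightarrow> ival \<Rightarrow> bool" where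
  "x < y \<longleftrightarrow> x \<le> y \<and> \<not> y \<le> (x::ival)"

instance
  by standard
    (auto simp: less_eq_ival_def less_ival_def ival_eq_iff lo_le_hi intro: antisym)

end

lemma ival_le_iff: "x \<le> y \<longleftrightarrow> lo x \<le> lo y \<and> hi y \<le> hi x"
  by (auto simp: less_eq_ival_def lo_le_hi)

lemma is_sup_in_ival:
  assumes "directed_family D"
  shows "is_sup_in UNIV D (mk_ival (SUP x\<in>D. lo x) (INF x\<in>D. hi x))"
proof -
  have ne: "D \<noteq> {}" using assms by (simp add: directed_family_def)
  have "lo x \<le> hi y" if xy: "x \<in> D" "y \<in> D" for x y
  proof -
    obtain z where "x \<le> z" "y \<le> z"
      using assms xy by (meson directed_family_def)
    then show ?thesis
      using lo_le_hi[of z] by (auto simp: ival_le_iff intro: order_trans)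
  qed
  then have "(SUP x\<in>D. lo x) \<le> (INF x\<in>D. hi x)"
    by (intro SUP_least INF_greatest)
  then show ?thesis
    by (auto simp: is_sup_in_def ival_le_iff intro: SUP_upper INF_lower SUP_least INF_greatest)
qed

instantiation ival :: topological_space
begin

definition open_ival :: "ival set \<Rightarrow> bool" where
  "open_ival U \<longleftrightarrow> scott_open U"

instance
proof
  show "open (UNIV :: ival set)"
    by (auto simp: open_ival_def scott_open_def directed_family_def)
next
  fix S T :: "ival set"
  assume ST: "open S" "open T"
  then have upS: "\<And>x y. x \<in> S \<Longrightarrow> x \<le> y \<Longrightarrow> y \<in> S"
    and upT: "\<And>x y. x \<in> T \<Longrightarrow> x \<le> y \<Longrightarrow> y \<in> T"
    unfolding open_ival_def scott_open_def by blast+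
  have "D \<inter> (S \<inter> T) \<noteq> {}"
    if D: "directed_family D" and s: "is_sup_in UNIV D s" "s \<in> S \<inter> T" for D s
  proof -
    have "D \<inter> S \<noteq> {}" "D \<inter> T \<noteq> {}"
      using ST D s unfolding open_ival_def scott_open_def by blast+
    then obtain x y where xy: "x \<in> D" "x \<in> S" "y \<in> D" "y \<in> T" by blast
    then obtain z where "z \<in> D" "x \<le> z" "y \<le> z"
      using D unfolding directed_family_def by blast
    then show ?thesis using xy upS upT by blast
  qed
  then show "open (S \<inter> T)"
    unfolding open_ival_def scott_open_def using upS upT by blast
next
  fix K :: "ival set set"
  assume "\<forall>S\<in>K. open S"
  then show "open (\<Union>K)"
    unfolding open_ival_def scott_open_def by (meson Union_iff disjoint_iff)
qed

end

instantiation ival :: "{zero, one, plus}"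
begin

lift_definition zero_ival :: ival is "(0, 0)" by simp

lift_definition one_ival :: ival is "(1, 1)" by simp

lift_definition plus_ival :: "ival \<Rightarrow> ival \<Rightarrow> ival" is "\<lambda>(a, b) (c, d). (a + c, b + d)"
  by (auto intro: add_mono)

instance ..

end

text \<open>The two products differ only in the value of \<open>0 \<cdot> \<infinity>\<close>, which is \<open>0\<close>
  for \<open>*\<close> on \<^typ>\<open>ennreal\<close>.\<close>
definition times_r :: "ennreal \<Rightarrow> ennreal \<Rightarrow> ennreal" where
  "times_r b d = (if b = 0 \<and> d = \<infinity> \<or> b = \<infinity> \<and> d = 0 then \<infinity> else b * d)"

lemma times_le_times_r: "a \<le> b \<Longrightarrow> c \<le> d \<Longrightarrow> a * c \<le> times_r b d"
  by (auto simp: times_r_def intro: mult_mono)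

instantiation ival :: times
begin

lift_definition times_ival :: "ival \<Rightarrow> ival \<Rightarrow> ival"
  is "\<lambda>(a, b) (c, d). (a * c, times_r b d)"
  by (auto intro: times_le_times_r)

instance ..

end

definition lmaps :: "('a::topological_space \<Rightarrow> ival) set" where
  "lmaps = {h. continuous_on UNIV h}"

text \<open>Only the values of \<open>\<nu>\<close> on \<^const>\<open>lmaps\<close> are relevant.\<close>
definition continuous_ival_valuation :: "(('a::topological_space \<Rightarrow> ival) \<Rightarrow> ival) \<Rightarrow> bool" where
  "continuous_ival_valuation \<nu> \<longleftrightarrow>
     scott_continuous_on lmaps \<nu> \<and>
     (\<forall>a. \<forall>h\<in>lmaps. \<nu> (\<lambda>x. a * h x) = a * \<nu> h) \<and>
     (\<forall>h\<in>lmaps. \<forall>h'\<in>lmaps. \<nu> (\<lambda>x. h x + h' x) = \<nu> h + \<nu> h')"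

definition saturated :: "'a::topological_space set \<Rightarrow> bool" where
  "saturated S \<longleftrightarrow> (\<exists>\<U>. (\<forall>U\<in>\<U>. open U) \<and> S = \<Inter>\<U>)"

definition irreducible_closed :: "'a::topological_space set \<Rightarrow> bool" where
  "irreducible_closed C \<longleftrightarrow>
     closed C \<and> C \<noteq> {} \<and>
     (\<forall>F G. closed F \<and> closed G \<and> C \<subseteq> F \<union> G \<longrightarrow> C \<subseteq> F \<or> C \<subseteq> G)"

definition sober :: "'a::topological_space itself \<Rightarrow> bool" where
  "sober _ \<longleftrightarrow> (\<forall>C::'a set. irreducible_closed C \<longrightarrow> (\<exists>!x. C = closure {x}))"

definition coherent :: "'a::topological_space itself \<Rightarrow> bool" where
  "coherent _ \<longleftrightarrow>
     (\<forall>P Q::'a set. compact P \<and> saturated P \<and> compact Q \<and> saturated Q \<longrightarrow> compact (P \<inter> Q))"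

text \<open>Local compactness without Hausdorffness: every point has a base of compact
  neighbourhoods, which is what \<^const>\<open>locally\<close> expresses.\<close>
definition stably_compact :: "'a::topological_space itself \<Rightarrow> bool" where
  "stably_compact T \<longleftrightarrow>
     sober T \<and> locally compact (UNIV::'a set) \<and> compact (UNIV::'a set) \<and> coherent T"

definition patch_topology :: "'a::topological_space topology" where
  "patch_topology =
     topology_generated_by ({U. open U} \<union> {- Q | Q. compact Q \<and> saturated Q})"

definition tau_smooth :: "'a::topological_space measure \<Rightarrow> bool" where
  "tau_smooth \<mu> \<longleftrightarrow>
     (\<forall>\<U>. (\<forall>U\<in>\<U>. open U) \<and> directed_family \<U> \<longrightarrow>
        emeasure \<mu> (\<Union>\<U>) = (SUP U\<in>\<U>. emeasure \<mu> U))"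

definition is_support :: "'a measure \<Rightarrow> 'a set \<Rightarrow> bool" where
  "is_support \<mu> E \<longleftrightarrow>
     E \<subseteq> space \<mu> \<and>
     (\<forall>A\<in>sets \<mu>. \<forall>B\<in>sets \<mu>. A \<inter> E = B \<inter> E \<longrightarrow> emeasure \<mu> A = emeasure \<mu> B)"

text \<open>The smallest closed support; it exists if \<open>\<mu>\<close> is \<open>\<tau>\<close>-smooth.\<close>
definition supp :: "'a::topological_space measure \<Rightarrow> 'a set" where
  "supp \<mu> = (LEAST F. closed F \<and> is_support \<mu> F)"

definition lower_integral :: "'a measure \<Rightarrow> ('a \<Rightarrow> ennreal) \<Rightarrow> ennreal" where
  "lower_integral \<mu> f = (SUP r\<in>{r::ennreal. r < \<infinity>}. \<integral>\<^sup>+ x. min (f x) r \<partial>\<mu>)"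

definition mu_bounded :: "'a::topological_space measure \<Rightarrow> ('a \<Rightarrow> ennreal) \<Rightarrow> bool" where
  "mu_bounded \<mu> f \<longleftrightarrow>
     (\<exists>Q\<in>sets \<mu>. compact Q \<and> saturated Q \<and> is_support \<mu> Q \<and> (SUP x\<in>Q \<inter> supp \<mu>. f x) < \<infinity>)"

definition upper_integral :: "'a::topological_space measure \<Rightarrow> ('a \<Rightarrow> ennreal) \<Rightarrow> ennreal" where
  "upper_integral \<mu> f = (if mu_bounded \<mu> f then lower_integral \<mu> f else \<infinity>)"

definition mu_tilde :: "'a::topological_space measure \<Rightarrow> ('a \<Rightarrow> ival) \<Rightarrow> ival" where
  "mu_tilde \<mu> h =
     mk_ival (lower_integral \<mu> (\<lambda>x. lo (h x))) (upper_integral \<mu> (\<lambda>x. hi (h x)))"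

lemma lower_le_upper_integral:
  "lower_integral \<mu> (\<lambda>x. lo (h x)) \<le> upper_integral \<mu> (\<lambda>x. hi (h x))"
  unfolding upper_integral_def lower_integral_def
  by (auto intro!: SUP_mono' nn_integral_mono min.mono simp: lo_le_hi)

definition approximates :: "ival \<Rightarrow> ennreal \<Rightarrow> bool" where
  "approximates I x \<longleftrightarrow> lo I \<le> x \<and> x \<le> hi I"

definition approximates_measure ::
    "(('a::topological_space \<Rightarrow> ival) \<Rightarrow> ival) \<Rightarrow> 'a measure \<Rightarrow> bool" where
  "approximates_measure \<nu> \<mu> \<longleftrightarrow>
     (\<forall>f\<in>borel_measurable \<mu>. \<forall>h\<in>lmaps.
        (\<forall>x. approximates (h x) (f x)) \<longrightarrow> approximates (\<nu> h) (lower_integral \<mu> f))"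

end

theory Submission
  imports Defs
begin

text \<open>By the Lindelof property, suprema of directed families of maps are suprema of chains, so
  monotone convergence gives Scott continuity of \<open>mu_tilde \<mu>\<close>. For the upper integral, an upper
  semicontinuous function that is finite on a compact set is bounded there; hence \<open>\<mu>\<close>-boundedness
  of a chain's infimum is already attained at some member of the chain.

  For maximality, let \<open>\<nu>\<close> approximate \<open>\<mu>\<close>. Only the case where the upper part of \<open>h\<close> is not
  \<open>\<mu>\<close>-bounded is not immediate. The saturation of \<open>K\<close> is a compact saturated support, so that upper
  part is infinite at some \<open>k\<close> in \<open>K\<close> and in the support of \<open>\<mu>\<close>. Separating \<open>k\<close> in \<open>K\<close> from compact
  saturated sets shows that the closed set \<open>C\<close> where it is infinite is a decreasing intersection of
  closed sets of positive measure, which yields an upper semicontinuous \<open>u\<close>, infinite exactly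
  on \<open>C\<close>, of infinite integral. As \<open>0 \<times> [0, u] = 0 \<times> h\<close> and \<open>\<nu> [0, u]\<close> is unbounded, so is \<open>\<nu> h\<close>.\<close>

section \<open>Endpoint arithmetic and the Scott topology of intervals\<close>

lemma lo_times: "lo (a * b) = lo a * lo b"
  and hi_times: "hi (a * b) = times_r (hi a) (hi b)"
  and lo_plus: "lo (a + b) = lo a + lo b"
  and hi_plus: "hi (a + b) = hi a + hi b"
  and lo_zero: "lo 0 = 0"
  and hi_zero: "hi 0 = 0"
  by (transfer; auto)+

text \<open>Since \<open>0\<close> times \<open>\<infinity>\<close> is \<open>\<infinity>\<close>
  here, a finite product forces both factors to be finite, even next to a factor \<open>0\<close>.
  This lets mu-boundedness pass from a product to its factors.\<close>

lemma times_r_less_top_iff: "times_r a b < \<infinity> \<longleftrightarrow> a < \<infinity> \<and> b < \<infinity>"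
  by (auto simp: times_r_def ennreal_mult_less_top less_top)

lemma times_r_mono: "b \<le> c \<Longrightarrow> times_r a b \<le> times_r a c"
  by (auto simp: times_r_def top_unique intro: mult_left_mono)

lemma is_sup_in_unique: "is_sup_in A D s \<Longrightarrow> is_sup_in A D t \<Longrightarrow> s = t"
  unfolding is_sup_in_def by (meson order.antisym)

lemma is_sup_in_ival_iff:
  assumes "directed_family D"
  shows "is_sup_in UNIV D s \<longleftrightarrow> lo s = (SUP x\<in>D. lo x) \<and> hi s = (INF x\<in>D. hi x)"
proof -
  let ?t = "mk_ival (SUP x\<in>D. lo x) (INF x\<in>D. hi x)"
  have sup: "is_sup_in UNIV D ?t"
    using assms by (rule is_sup_in_ival)
  \<comment> \<open>\<open>mk_ival\<close> has the intended end points only if they are in order;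
    directedness ensures it.\<close>
  have le: "(SUP x\<in>D. lo x) \<le> (INF x\<in>D. hi x)"
  proof (intro SUP_least INF_greatest)
    fix x y assume "x \<in> D" "y \<in> D"
    then obtain z where "x \<le> z" "y \<le> z"
      using assms by (meson directed_family_def)
    then show "lo x \<le> hi y"
      using lo_le_hi[of z] by (auto simp: ival_le_iff intro: order_trans)
  qed
  have "is_sup_in UNIV D s \<longleftrightarrow> s = ?t"
    using sup is_sup_in_unique by blast
  then show ?thesis
    using le by (simp add: ival_eq_iff)
qed

lemma directed_family_image:
  assumes "directed_family D" "mono_on D f"
  shows "directed_family (f ` D)"
  using assms unfolding directed_family_def mono_on_def
  by (simp add: ball_simps) (meson)

lemma open_lo_greater: "open {I::ival. r < lo I}"
  unfolding open_ival_def scott_open_def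
  by (auto simp: ival_le_iff is_sup_in_ival_iff less_SUP_iff intro: less_le_trans)

lemma open_hi_less: "open {I::ival. hi I < r}"
  unfolding open_ival_def scott_open_def
  by (auto simp: ival_le_iff is_sup_in_ival_iff INF_less_iff intro: le_less_trans)

section \<open>Continuous interval-valued maps and their suprema\<close>

lemma lmaps_open_vimage: "h \<in> lmaps \<Longrightarrow> open U \<Longrightarrow> open {x. h x \<in> U}"
  using open_vimage[of U h] by (simp add: lmaps_def vimage_def)

lemma lmaps_lo_open: "h \<in> lmaps \<Longrightarrow> open {x. r < lo (h x)}"
  using lmaps_open_vimage[OF _ open_lo_greater] by auto

lemma lmaps_hi_open: "h \<in> lmaps \<Longrightarrow> open {x. hi (h x) < r}"
  using lmaps_open_vimage[OF _ open_hi_less] by auto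

text \<open>For finite \<open>u x\<close>, the interval \<open>mk_ival 0 (u x)\<close> is the
  directed supremum of the \<open>mk_ival 0 b\<close> with \<open>b > u x\<close>. A Scott-open set
  containing it thus contains some \<open>mk_ival 0 b\<close>, and \<open>{y. u y < b}\<close> is
  the neighbourhood of \<open>x\<close> sought.\<close>

lemma upper_map_in_lmaps:
  fixes u :: "'a::topological_space \<Rightarrow> ennreal"
  assumes "\<And>r. open {x. u x < r}"
  shows "(\<lambda>x. mk_ival 0 (u x)) \<in> lmaps"
proof -
  have "open {x. mk_ival 0 (u x) \<in> U}" if U: "open U" for U
  proof (subst open_subopen, safe)
    fix x assume x: "mk_ival 0 (u x) \<in> U"
    have up: "b \<in> U" if "a \<in> U" "a \<le> b" for a b
      using U that unfolding open_ival_def scott_open_def by blast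
    show "\<exists>T. open T \<and> x \<in> T \<and> T \<subseteq> {x. mk_ival 0 (u x) \<in> U}"
    proof (cases "u x = \<infinity>")
      case True
      \<comment> \<open>\<open>mk_ival 0 \<infinity>\<close> is the least interval, so
        \<open>U\<close> is everything.\<close>
      have "mk_ival 0 (u y) \<in> U" for y
        using up[OF x] True by (simp add: ival_le_iff)
      then show ?thesis by auto
    next
      case False
      let ?D = "mk_ival 0 ` {u x<..}"
      have dir: "directed_family ?D"
      proof -
        have "\<exists>z\<in>?D. a \<le> z \<and> b \<le> z" if ab: "a \<in> ?D" "b \<in> ?D" for a b
        proof -
          obtain p q where "a = mk_ival 0 p" "b = mk_ival 0 q" "u x < p" "u x < q"
            using ab by blast
          then show ?thesis
            by (intro bexI[of _ "mk_ival 0 (min p q)"]) (auto simp: ival_le_iff)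
        qed
        moreover have "?D \<noteq> {}"
          using False by (auto simp: less_top)
        ultimately show ?thesis
          unfolding directed_family_def by blast
      qed
      have "(INF b\<in>{u x<..}. b) = u x"
        using False Inf_greaterThan[of "u x"] by (auto simp: less_top)
      moreover have "(SUP b\<in>{u x<..}. 0::ennreal) = 0"
        by (simp add: SUP_constant bot_ennreal)
      ultimately have "is_sup_in UNIV ?D (mk_ival 0 (u x))"
        by (simp add: is_sup_in_ival_iff[OF dir] image_comp)
      then have "?D \<inter> U \<noteq> {}"
        using U x dir unfolding open_ival_def scott_open_def by blast
      then obtain b where b: "u x < b" "mk_ival 0 b \<in> U" by auto
      have "{y. u y < b} \<subseteq> {x. mk_ival 0 (u x) \<in> U}"
        using up[OF b(2)] by (auto simp: ival_le_iff)
      then show ?thesis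
        using assms[of b] b(1) by blast
    qed
  qed
  then show ?thesis
    by (simp add: lmaps_def continuous_on_open_vimage vimage_def)
qed

text \<open>The pointwise supremum \<open>t\<close> is itself continuous, so it is also the supremum
  within \<open>lmaps\<close> and equals \<open>s\<close> by uniqueness.\<close>

lemma lmaps_sup_pointwise:
  fixes D :: "('a::topological_space \<Rightarrow> ival) set"
  assumes D: "D \<subseteq> lmaps" "directed_family D" and s: "is_sup_in lmaps D s"
  shows "lo (s x) = (SUP d\<in>D. lo (d x))" "hi (s x) = (INF d\<in>D. hi (d x))"
proof -
  define t where "t x = mk_ival (SUP d\<in>D. lo (d x)) (INF d\<in>D. hi (d x))" for x
  have dir: "directed_family ((\<lambda>d. d x) ` D)" for x
    by (rule directed_family_image[OF D(2)]) (auto simp: mono_on_def le_fun_def)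
  have t: "is_sup_in UNIV ((\<lambda>d. d x) ` D) (t x)" for x
    using is_sup_in_ival[OF dir[of x]] by (simp add: t_def image_comp)
  have "open {x. t x \<in> U}" if U: "open U" for U
  proof -
    \<comment> \<open>A Scott-open set contains a directed supremum iff it meets the family, so
      preimages under \<open>t\<close> are unions of preimages under members of
      \<open>D\<close>.\<close>
    have "t x \<in> U \<longleftrightarrow> (\<exists>d\<in>D. d x \<in> U)" for x
    proof
      assume "t x \<in> U"
      then have "(\<lambda>d. d x) ` D \<inter> U \<noteq> {}"
        using U t[of x] dir[of x] unfolding open_ival_def scott_open_def by blast
      then show "\<exists>d\<in>D. d x \<in> U" by auto
    next
      assume "\<exists>d\<in>D. d x \<in> U"
      then show "t x \<in> U"
        using U t[of x] unfolding open_ival_def scott_open_def is_sup_in_def by blast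
    qed
    then have "{x. t x \<in> U} = (\<Union>d\<in>D. {x. d x \<in> U})" by auto
    then show ?thesis
      using D(1) U by (auto intro!: open_UN lmaps_open_vimage)
  qed
  then have tl: "t \<in> lmaps"
    by (simp add: lmaps_def continuous_on_open_vimage vimage_def)
  have "is_sup_in lmaps D t"
    using t tl unfolding is_sup_in_def le_fun_def by blast
  then have "s = t"
    using s is_sup_in_unique by blast
  then show "lo (s x) = (SUP d\<in>D. lo (d x))" "hi (s x) = (INF d\<in>D. hi (d x))"
    using t[of x] by (simp_all add: is_sup_in_ival_iff[OF dir] image_comp)
qed

section \<open>From directed families to chains\<close>

text \<open>Selecting indices rather than open sets yields countably many maps in the application to
  families of maps.\<close>

lemma Lindelof_family:
  fixes U :: "'i \<Rightarrow> 'a::second_countable_topology set"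
  assumes "\<And>i. i \<in> I \<Longrightarrow> open (U i)"
  obtains J where "J \<subseteq> I" "countable J" "(\<Union>i\<in>J. U i) = (\<Union>i\<in>I. U i)"
proof -
  obtain F where F: "F \<subseteq> U ` I" "countable F" "\<Union>F = (\<Union>i\<in>I. U i)"
    using Lindelof[of "U ` I"] assms by blast
  then obtain J where "J \<subseteq> I" "countable J" "F = U ` J"
    using countable_subset_image[of F U I] by blast
  with F(3) that show ?thesis by blast
qed

text \<open>Dependent choice: each term is a member of \<open>D\<close> above the previous term and
  above the next element in an enumeration of \<open>E\<close>.\<close>

lemma directed_countable_chain:
  fixes D :: "'p::order set"
  assumes D: "directed_family D" and E: "E \<subseteq> D" "countable E"
  obtains c :: "nat \<Rightarrow> 'p" where "incseq c" "range c \<subseteq> D" "\<And>e. e \<in> E \<Longrightarrow> \<exists>n. e \<le> c n"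
proof -
  obtain d0 where d0: "d0 \<in> D"
    using D by (auto simp: directed_family_def)
  \<comment> \<open>\<open>from_nat_into\<close> enumerates only non-empty sets; adding
    \<open>d0\<close> covers the case of an empty \<open>E\<close>.\<close>
  define e where "e = from_nat_into (insert d0 E)"
  have eD: "e n \<in> D" for n
    using from_nat_into[of "insert d0 E" n] E d0 by (auto simp: e_def)
  have "\<exists>c. \<forall>n. (c n \<in> D \<and> e n \<le> c n) \<and> c n \<le> c (Suc n)"
  proof (rule dependent_nat_choice)
    show "\<exists>x. x \<in> D \<and> e 0 \<le> x"
      using eD by blast
  next
    fix x n assume "x \<in> D \<and> e n \<le> x"
    then show "\<exists>y. (y \<in> D \<and> e (Suc n) \<le> y) \<and> x \<le> y"
      using D eD[of "Suc n"] unfolding directed_family_def by blast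
  qed
  then obtain c where c: "\<And>n. c n \<in> D" "\<And>n. e n \<le> c n" "\<And>n. c n \<le> c (Suc n)"
    by blast
  have "\<exists>n. a \<le> c n" if a: "a \<in> E" for a
  proof -
    have "a \<in> range e"
      using a E(2) range_from_nat_into[of "insert d0 E"] by (auto simp: e_def)
    then show ?thesis using c(2) by blast
  qed
  then show ?thesis
    using that[of c] c by (auto simp: incseq_Suc_iff)
qed

text \<open>For one threshold \<open>b\<close>, Lindelof gives countably many members of
  \<open>D\<close> that witness \<open>b < lo (s x)\<close> and \<open>hi (s x) < b\<close> wherever
  these hold. Countably many thresholds suffice, and a chain dominating all these members has the
  same pointwise supremum as \<open>D\<close>.\<close>

lemma directed_sup_is_chain_sup:
  fixes D :: "('a::second_countable_topology \<Rightarrow> ival) set"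
  assumes D: "D \<subseteq> lmaps" "directed_family D" and s: "is_sup_in lmaps D s"
  obtains c :: "nat \<Rightarrow> 'a \<Rightarrow> ival" where "incseq c" "range c \<subseteq> D"
    "\<And>x. lo (s x) = (SUP n. lo (c n x))" "\<And>x. hi (s x) = (INF n. hi (c n x))"
proof -
  \<comment> \<open>The thresholds: a strict gap between two end points always contains one.\<close>
  obtain B :: "ennreal set" where B: "countable B" "\<And>x y. x < y \<Longrightarrow> \<exists>b\<in>B. x < b \<and> b < y"
    using countable_separating_set_dense_linorder by metis
  have "\<exists>J\<subseteq>D. countable J \<and> (\<Union>d\<in>J. {x. b < lo (d x)}) = (\<Union>d\<in>D. {x. b < lo (d x)})" for b
  proof -
    have "open {x. b < lo (d x)}" if "d \<in> D" for d
      using that D(1) lmaps_lo_open by blast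
    then show ?thesis
      using Lindelof_family[of D "\<lambda>d. {x. b < lo (d x)}"] by metis
  qed
  then obtain J where J: "\<And>b. J b \<subseteq> D" "\<And>b. countable (J b)"
    "\<And>b. (\<Union>d\<in>J b. {x. b < lo (d x)}) = (\<Union>d\<in>D. {x. b < lo (d x)})"
    by metis
  have "\<exists>J\<subseteq>D. countable J \<and> (\<Union>d\<in>J. {x. hi (d x) < b}) = (\<Union>d\<in>D. {x. hi (d x) < b})" for b
  proof -
    have "open {x. hi (d x) < b}" if "d \<in> D" for d
      using that D(1) lmaps_hi_open by blast
    then show ?thesis
      using Lindelof_family[of D "\<lambda>d. {x. hi (d x) < b}"] by metis
  qed
  then obtain L where L: "\<And>b. L b \<subseteq> D" "\<And>b. countable (L b)"
    "\<And>b. (\<Union>d\<in>L b. {x. hi (d x) < b}) = (\<Union>d\<in>D. {x. hi (d x) < b})"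
    by metis
  define E where "E = (\<Union>b\<in>B. J b \<union> L b)"
  have "E \<subseteq> D"
    using J(1) L(1) unfolding E_def by blast
  moreover have "countable E"
    using J(2) L(2) B(1) by (auto simp: E_def)
  ultimately obtain c where c: "incseq c" "range c \<subseteq> D" "\<And>e. e \<in> E \<Longrightarrow> \<exists>n. e \<le> c n"
    using directed_countable_chain[OF D(2)] by metis
  note sx = lmaps_sup_pointwise[OF D s]
  have "lo (s x) = (SUP n. lo (c n x))" for x
  proof (rule antisym)
    show "(SUP n. lo (c n x)) \<le> lo (s x)"
      unfolding sx using c(2) by (intro SUP_mono) auto
    show "lo (s x) \<le> (SUP n. lo (c n x))"
    proof (rule ccontr)
      assume "\<not> ?thesis"
      then obtain b where b: "b \<in> B" "(SUP n. lo (c n x)) < b" "b < lo (s x)"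
        using B(2) by (meson not_le)
      then have "x \<in> (\<Union>d\<in>D. {x. b < lo (d x)})"
        by (simp add: sx less_SUP_iff)
      then obtain e where e: "e \<in> J b" "b < lo (e x)"
        unfolding J(3)[symmetric] by blast
      then obtain n where "e \<le> c n"
        using c(3) b(1) by (auto simp: E_def)
      then have "lo (e x) \<le> lo (c n x)"
        by (simp add: le_fun_def ival_le_iff)
      also have "\<dots> \<le> (SUP n. lo (c n x))"
        by (rule SUP_upper) simp
      finally show False
        using b e by simp
    qed
  qed
  moreover have "hi (s x) = (INF n. hi (c n x))" for x
  proof (rule antisym)
    show "hi (s x) \<le> (INF n. hi (c n x))"
      unfolding sx using c(2) by (intro INF_mono) auto
    show "(INF n. hi (c n x)) \<le> hi (s x)"
    proof (rule ccontr)
      assume "\<not> ?thesis"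
      then obtain b where b: "b \<in> B" "hi (s x) < b" "b < (INF n. hi (c n x))"
        using B(2) by (meson not_le)
      then have "x \<in> (\<Union>d\<in>D. {x. hi (d x) < b})"
        by (simp add: sx INF_less_iff)
      then obtain e where e: "e \<in> L b" "hi (e x) < b"
        unfolding L(3)[symmetric] by blast
      then obtain n where "e \<le> c n"
        using c(3) b(1) by (auto simp: E_def)
      then have "hi (c n x) \<le> hi (e x)"
        by (simp add: le_fun_def ival_le_iff)
      moreover have "(INF n. hi (c n x)) \<le> hi (c n x)"
        by (rule INF_lower) simp
      ultimately show False
        using b e by simp
    qed
  qed
  ultimately show ?thesis
    using that c by blast
qed

section \<open>Lower integrals, supports and mu-boundedness\<close>

text \<open>Truncations at natural numbers increase to \<open>f\<close>, also where \<open>f\<close>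
  is infinite, so monotone convergence applies.\<close>

lemma lower_integral_eq_nn_integral:
  assumes f: "f \<in> borel_measurable \<mu>"
  shows "lower_integral \<mu> f = (\<integral>\<^sup>+ x. f x \<partial>\<mu>)"
proof (rule antisym)
  show "lower_integral \<mu> f \<le> (\<integral>\<^sup>+ x. f x \<partial>\<mu>)"
    unfolding lower_integral_def by (intro SUP_least nn_integral_mono) simp
  have "(SUP n. min (f x) (of_nat n)) = f x" for x
    using inf_SUP[of "f x" of_nat "UNIV :: nat set"] ennreal_SUP_of_nat_eq_top
    by (simp add: inf_min)
  then have "(\<integral>\<^sup>+ x. f x \<partial>\<mu>) = (\<integral>\<^sup>+ x. (SUP n. min (f x) (of_nat n)) \<partial>\<mu>)"
    by simp
  also have "\<dots> = (SUP n. \<integral>\<^sup>+ x. min (f x) (of_nat n) \<partial>\<mu>)"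
    using f by (intro nn_integral_monotone_convergence_SUP)
      (auto simp: incseq_def le_fun_def intro: min.coboundedI2)
  also have "\<dots> \<le> lower_integral \<mu> f"
    unfolding lower_integral_def by (intro SUP_least SUP_upper) (simp add: of_nat_less_top)
  finally show "(\<integral>\<^sup>+ x. f x \<partial>\<mu>) \<le> lower_integral \<mu> f" .
qed

lemma usc_bounded_on_compact:
  fixes f :: "'a::topological_space \<Rightarrow> ennreal"
  assumes "compact S" "\<And>r. open {x. f x < r}" "\<And>x. x \<in> S \<Longrightarrow> f x < \<infinity>"
  shows "(SUP x\<in>S. f x) < \<infinity>"
proof -
  have "S \<subseteq> (\<Union>n. {x. f x < of_nat n})"
    using assms(3) by (auto simp: less_top) (metis ennreal_Ex_less_of_nat infinity_ennreal_def)
  then obtain J where J: "finite J" "S \<subseteq> (\<Union>n\<in>J. {x. f x < of_nat n})"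
    using compactE_image[OF assms(1), of UNIV "\<lambda>n. {x. f x < of_nat n}"] assms(2) by metis
  \<comment> \<open>The sum dominates every index in \<open>J\<close> and needs no case distinction
    for an empty \<open>J\<close>.\<close>
  have "f x \<le> (\<Sum>n\<in>J. of_nat n)" if x: "x \<in> S" for x
  proof -
    obtain n where "n \<in> J" "f x < of_nat n"
      using J(2) x by blast
    then show ?thesis
      using member_le_sum[of n J "of_nat :: nat \<Rightarrow> ennreal"] J(1) by fastforce
  qed
  then have "(SUP x\<in>S. f x) \<le> (\<Sum>n\<in>J. of_nat n)"
    by (rule SUP_least)
  also have "\<dots> < \<infinity>"
    using J(1) by (simp add: less_top[symmetric])
  finally show ?thesis .
qed

lemma space_borel_sets: "sets \<mu> = sets (borel :: 'a::topological_space measure) \<Longrightarrow> space \<mu> = UNIV"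
  using sets_eq_imp_space_eq by fastforce

text \<open>\<open>- E\<close> and \<open>{}\<close> have the same trace on \<open>E\<close>;
  conversely a measurable set and its trace on \<open>E\<close> differ by a part of
  \<open>- E\<close>.\<close>

lemma is_support_iff_null_Compl:
  fixes \<mu> :: "'a::topological_space measure"
  assumes "sets \<mu> = sets borel" "E \<in> sets \<mu>"
  shows "is_support \<mu> E \<longleftrightarrow> emeasure \<mu> (- E) = 0"
proof
  have m: "- E \<in> sets \<mu>"
    using assms by (simp add: borel_comp)
  assume "is_support \<mu> E"
  then have "emeasure \<mu> (- E) = emeasure \<mu> {}"
    using m unfolding is_support_def by (metis Compl_disjoint2 Int_empty_left sets.empty_sets)
  then show "emeasure \<mu> (- E) = 0" by simp
next
  assume 0: "emeasure \<mu> (- E) = 0"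
  have m: "- E \<in> sets \<mu>"
    using assms by (simp add: borel_comp)
  have "emeasure \<mu> A = emeasure \<mu> (A \<inter> E)" if "A \<in> sets \<mu>" for A
  proof -
    have "A - - E = A \<inter> E" by auto
    then show ?thesis
      using emeasure_Diff_null_set[of "- E" \<mu> A] 0 m that by (simp add: null_sets_def)
  qed
  then show "is_support \<mu> E"
    using space_borel_sets[OF assms(1)] unfolding is_support_def by (metis subset_UNIV)
qed

text \<open>By Lindelof the union of all null open sets is null. Its complement is thus a closed
  support, and the least one, so the \<open>LEAST\<close> in \<open>supp\<close> is
  attained.\<close>

lemma supp_is_support:
  fixes \<mu> :: "'a::second_countable_topology measure"
  assumes b: "sets \<mu> = sets borel"
  shows "closed (supp \<mu>)" "is_support \<mu> (supp \<mu>)"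
    and "\<And>x U. x \<in> supp \<mu> \<Longrightarrow> open U \<Longrightarrow> x \<in> U \<Longrightarrow> emeasure \<mu> U \<noteq> 0"
proof -
  define N where "N = {U. open U \<and> emeasure \<mu> U = 0}"
  obtain N' where N': "N' \<subseteq> N" "countable N'" "\<Union>N' = \<Union>N"
    using Lindelof[of N] by (auto simp: N_def)
  have "\<Union>N' \<in> null_sets \<mu>"
    using N' b by (intro null_sets_UN'[of N' "\<lambda>x. x", simplified]) (auto simp: N_def null_sets_def)
  then have 0: "emeasure \<mu> (\<Union>N) = 0"
    using N' by auto
  have cl: "closed (- \<Union>N)"
    by (auto simp: N_def)
  then have "is_support \<mu> (- \<Union>N)"
    using is_support_iff_null_Compl[OF b, of "- \<Union>N"] 0 b by simp
  moreover have "- \<Union>N \<subseteq> F" if "closed F \<and> is_support \<mu> F" for F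
  proof -
    have "- F \<in> N"
      using that is_support_iff_null_Compl[OF b, of F] b by (auto simp: N_def)
    then show ?thesis by blast
  qed
  ultimately have "supp \<mu> = - \<Union>N"
    unfolding supp_def using cl by (intro Least_equality) auto
  with cl \<open>is_support \<mu> (- \<Union>N)\<close>
  show "closed (supp \<mu>)" "is_support \<mu> (supp \<mu>)"
    and "\<And>x U. x \<in> supp \<mu> \<Longrightarrow> open U \<Longrightarrow> x \<in> U \<Longrightarrow> emeasure \<mu> U \<noteq> 0"
    by (auto simp: N_def)
qed

lemma is_support_Int:
  fixes \<mu> :: "'a::topological_space measure"
  assumes b: "sets \<mu> = sets borel"
    and "P \<in> sets \<mu>" "Q \<in> sets \<mu>" "is_support \<mu> P" "is_support \<mu> Q"
  shows "is_support \<mu> (P \<inter> Q)"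
proof -
  have "- P \<in> null_sets \<mu>" "- Q \<in> null_sets \<mu>"
    using assms by (auto simp: is_support_iff_null_Compl null_sets_def borel_comp)
  then have "- P \<union> - Q \<in> null_sets \<mu>"
    by (rule null_sets.Un)
  then show ?thesis
    using assms by (subst is_support_iff_null_Compl) auto
qed

lemma saturated_Int: "saturated P \<Longrightarrow> saturated Q \<Longrightarrow> saturated (P \<inter> Q)"
  unfolding saturated_def by (metis Inter_Un_distrib Un_iff)

text \<open>On the compact set \<open>Q \<inter> supp \<mu>\<close>, upper semicontinuity turns
  pointwise finiteness into a bound.\<close>

lemma mu_bounded_iff:
  fixes \<mu> :: "'a::second_countable_topology measure"
  assumes b: "sets \<mu> = sets borel" and f: "\<And>r. open {x. f x < r}"
  shows "mu_bounded \<mu> f \<longleftrightarrow> (\<exists>Q\<in>sets \<mu>. compact Q \<and> saturated Q \<and> is_support \<mu> Q \<and>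
    (\<forall>x\<in>Q \<inter> supp \<mu>. f x < \<infinity>))"
proof -
  have "(SUP x\<in>Q \<inter> supp \<mu>. f x) < \<infinity> \<longleftrightarrow> (\<forall>x\<in>Q \<inter> supp \<mu>. f x < \<infinity>)" if "compact Q" for Q
    using usc_bounded_on_compact[of "Q \<inter> supp \<mu>" f] compact_Int_closed[OF that supp_is_support(1)[OF b]] f
    by (meson SUP_lessD)
  then show ?thesis
    unfolding mu_bounded_def by blast
qed

lemma mu_bounded_mono:
  assumes "mu_bounded \<mu> g" "\<And>x. f x \<le> g x"
  shows "mu_bounded \<mu> f"
proof -
  obtain Q where Q: "Q \<in> sets \<mu>" "compact Q" "saturated Q" "is_support \<mu> Q"
    "(SUP x\<in>Q \<inter> supp \<mu>. g x) < \<infinity>"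
    using assms(1) by (auto simp: mu_bounded_def)
  have "(SUP x\<in>Q \<inter> supp \<mu>. f x) \<le> (SUP x\<in>Q \<inter> supp \<mu>. g x)"
    using assms(2) by (intro SUP_mono') auto
  then show ?thesis
    using Q unfolding mu_bounded_def by (meson le_less_trans)
qed

text \<open>\<open>Q \<inter> supp \<mu>\<close> is a support, so its complement is null and the
  supremum over it is an almost everywhere bound.\<close>

lemma mu_bounded_AE:
  fixes \<mu> :: "'a::second_countable_topology measure"
  assumes b: "sets \<mu> = sets borel" and f: "mu_bounded \<mu> f"
  obtains M where "M < \<infinity>" "AE x in \<mu>. f x \<le> M"
proof -
  obtain Q where Q: "Q \<in> sets \<mu>" "is_support \<mu> Q" "(SUP x\<in>Q \<inter> supp \<mu>. f x) < \<infinity>"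
    using f by (auto simp: mu_bounded_def)
  have s: "supp \<mu> \<in> sets \<mu>"
    using supp_is_support(1)[OF b] b by simp
  then have "is_support \<mu> (Q \<inter> supp \<mu>)"
    using is_support_Int[OF b Q(1)] Q(2) supp_is_support(2)[OF b] by blast
  then have "- (Q \<inter> supp \<mu>) \<in> null_sets \<mu>"
    using Q(1) s b is_support_iff_null_Compl[OF b, of "Q \<inter> supp \<mu>"]
    by (auto simp: null_sets_def borel_comp)
  then have "AE x in \<mu>. f x \<le> (SUP x\<in>Q \<inter> supp \<mu>. f x)"
    by (rule AE_I') (auto intro: SUP_upper)
  with Q(3) that show ?thesis by blast
qed

lemma mu_bounded_integral_finite:
  fixes \<mu> :: "'a::second_countable_topology measure"
  assumes b: "sets \<mu> = sets borel" and fin: "emeasure \<mu> (space \<mu>) < \<infinity>" and f: "mu_bounded \<mu> f"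
  shows "(\<integral>\<^sup>+ x. f x \<partial>\<mu>) < \<infinity>"
proof -
  obtain M where M: "M < \<infinity>" "AE x in \<mu>. f x \<le> M"
    using mu_bounded_AE[OF b f] .
  have "(\<integral>\<^sup>+ x. f x \<partial>\<mu>) \<le> (\<integral>\<^sup>+ x. M \<partial>\<mu>)"
    using M(2) by (rule nn_integral_mono_AE)
  also have "\<dots> < \<infinity>"
    using M(1) fin by (simp add: ennreal_mult_less_top)
  finally show ?thesis .
qed

text \<open>Coherence makes the intersection of the two witnessing sets compact, so that it serves
  both functions; the converse is monotonicity.\<close>

lemma mu_bounded_add_iff:
  fixes \<mu> :: "'a::second_countable_topology measure"
  assumes coh: "coherent TYPE('a)" and b: "sets \<mu> = sets borel"
  shows "mu_bounded \<mu> (\<lambda>x. f x + g x) \<longleftrightarrow> mu_bounded \<mu> f \<and> mu_bounded \<mu> g"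
proof (intro iffI conjI; (elim conjE)?)
  assume "mu_bounded \<mu> f" "mu_bounded \<mu> g"
  then obtain P Q where
    P: "P \<in> sets \<mu>" "compact P" "saturated P" "is_support \<mu> P" "(SUP x\<in>P \<inter> supp \<mu>. f x) < \<infinity>"
    and Q: "Q \<in> sets \<mu>" "compact Q" "saturated Q" "is_support \<mu> Q" "(SUP x\<in>Q \<inter> supp \<mu>. g x) < \<infinity>"
    by (auto simp: mu_bounded_def)
  have "(SUP x\<in>(P \<inter> Q) \<inter> supp \<mu>. f x + g x) \<le> (SUP x\<in>P \<inter> supp \<mu>. f x) + (SUP x\<in>Q \<inter> supp \<mu>. g x)"
    by (intro SUP_least add_mono SUP_upper) auto
  also have "\<dots> < \<infinity>"
    using P(5) Q(5) by simp
  finally show "mu_bounded \<mu> (\<lambda>x. f x + g x)"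
    unfolding mu_bounded_def
    using P Q is_support_Int[OF b] saturated_Int coh unfolding coherent_def by (meson sets.Int)
qed (erule mu_bounded_mono; simp)+

text \<open>A finite value of the product at a single point of \<open>Q \<inter> supp \<mu>\<close>
  makes the scalar finite; such a point exists because \<open>\<mu>\<close> is non-zero.\<close>

lemma mu_bounded_times_r_iff:
  fixes \<mu> :: "'a::second_countable_topology measure"
  assumes b: "sets \<mu> = sets borel" and nz: "emeasure \<mu> (space \<mu>) \<noteq> 0"
    and f: "\<And>r. open {x. f x < r}"
  shows "mu_bounded \<mu> (\<lambda>x. times_r a (f x)) \<longleftrightarrow> a < \<infinity> \<and> mu_bounded \<mu> f"
proof (intro iffI; (elim conjE)?)
  assume "mu_bounded \<mu> (\<lambda>x. times_r a (f x))"
  then obtain Q where Q: "Q \<in> sets \<mu>" "compact Q" "saturated Q" "is_support \<mu> Q"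
    "(SUP x\<in>Q \<inter> supp \<mu>. times_r a (f x)) < \<infinity>"
    by (auto simp: mu_bounded_def)
  have fin: "times_r a (f x) < \<infinity>" if "x \<in> Q \<inter> supp \<mu>" for x
    using Q(5) that by (meson SUP_lessD)
  have s: "supp \<mu> \<in> sets \<mu>"
    using supp_is_support(1)[OF b] b by simp
  have "is_support \<mu> (Q \<inter> supp \<mu>)"
    using is_support_Int[OF b Q(1) s Q(4)] supp_is_support(2)[OF b] by blast
  \<comment> \<open>The empty set is a support of the zero measure only.\<close>
  then have "Q \<inter> supp \<mu> \<noteq> {}"
    using nz is_support_iff_null_Compl[OF b, of "{}"] space_borel_sets[OF b] by auto
  then have "a < \<infinity>"
    using fin times_r_less_top_iff by auto
  moreover have "mu_bounded \<mu> f"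
    using mu_bounded_iff[OF b f] Q fin times_r_less_top_iff by blast
  ultimately show "a < \<infinity> \<and> mu_bounded \<mu> f" ..
next
  assume a: "a < \<infinity>" and "mu_bounded \<mu> f"
  then obtain Q where Q: "Q \<in> sets \<mu>" "compact Q" "saturated Q" "is_support \<mu> Q"
    "(SUP x\<in>Q \<inter> supp \<mu>. f x) < \<infinity>"
    by (auto simp: mu_bounded_def)
  have "(SUP x\<in>Q \<inter> supp \<mu>. times_r a (f x)) \<le> times_r a (SUP x\<in>Q \<inter> supp \<mu>. f x)"
    by (intro SUP_least times_r_mono SUP_upper)
  also have "\<dots> < \<infinity>"
    using a Q(5) times_r_less_top_iff by blast
  finally show "mu_bounded \<mu> (\<lambda>x. times_r a (f x))"
    using Q unfolding mu_bounded_def by blast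
qed

section \<open>Smoothness of the measure, and \<open>mu_tilde \<mu>\<close> as an approximating
  valuation\<close>

lemma lmaps_lo_measurable:
  fixes \<mu> :: "'a::topological_space measure"
  assumes "sets \<mu> = sets borel" "h \<in> lmaps"
  shows "(\<lambda>x. lo (h x)) \<in> borel_measurable \<mu>"
  using lmaps_lo_open[OF assms(2)] assms(1)
  by (intro borel_measurableI_greater) (simp add: space_borel_sets)

lemma lmaps_hi_measurable:
  fixes \<mu> :: "'a::topological_space measure"
  assumes "sets \<mu> = sets borel" "h \<in> lmaps"
  shows "(\<lambda>x. hi (h x)) \<in> borel_measurable \<mu>"
  using lmaps_hi_open[OF assms(2)] assms(1)
  by (intro borel_measurableI_less) (simp add: space_borel_sets)

lemma lo_mu_tilde_eq: "lo (mu_tilde \<mu> h) = lower_integral \<mu> (\<lambda>x. lo (h x))"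
  and hi_mu_tilde_eq: "hi (mu_tilde \<mu> h) = upper_integral \<mu> (\<lambda>x. hi (h x))"
  by (simp_all add: mu_tilde_def lower_le_upper_integral)

lemma lo_mu_tilde:
  assumes "sets \<mu> = sets borel" "h \<in> lmaps"
  shows "lo (mu_tilde \<mu> h) = (\<integral>\<^sup>+ x. lo (h x) \<partial>\<mu>)"
  using lmaps_lo_measurable[OF assms] by (simp add: lo_mu_tilde_eq lower_integral_eq_nn_integral)

lemma hi_mu_tilde:
  assumes "sets \<mu> = sets borel" "h \<in> lmaps"
  shows "hi (mu_tilde \<mu> h) =
    (if mu_bounded \<mu> (\<lambda>x. hi (h x)) then (\<integral>\<^sup>+ x. hi (h x) \<partial>\<mu>) else \<infinity>)"
  using lmaps_hi_measurable[OF assms]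
  by (simp add: hi_mu_tilde_eq upper_integral_def lower_integral_eq_nn_integral)

text \<open>A chain of members exhausts the directed union by Lindelof, and the measure is
  continuous from below along it.\<close>

lemma tau_smooth_second_countable:
  fixes \<mu> :: "'a::second_countable_topology measure"
  assumes b: "sets \<mu> = sets borel"
  shows "tau_smooth \<mu>"
  unfolding tau_smooth_def
proof safe
  fix \<U> :: "'a set set"
  assume op: "\<forall>U\<in>\<U>. open U" and dir: "directed_family \<U>"
  obtain E where E: "E \<subseteq> \<U>" "countable E" "\<Union>E = \<Union>\<U>"
    using Lindelof[of \<U>] op by blast
  obtain c where c: "incseq c" "range c \<subseteq> \<U>" "\<And>e. e \<in> E \<Longrightarrow> \<exists>n. e \<subseteq> c n"
    using directed_countable_chain[OF dir E(1,2)] by metis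
  have "(\<Union>n. c n) = \<Union>\<U>"
  proof
    show "(\<Union>n. c n) \<subseteq> \<Union>\<U>"
      using c(2) by blast
    show "\<Union>\<U> \<subseteq> (\<Union>n. c n)"
      unfolding E(3)[symmetric] using c(3) by blast
  qed
  moreover have "range c \<subseteq> sets \<mu>"
    using c(2) op b by auto
  ultimately have "emeasure \<mu> (\<Union>\<U>) = (SUP n. emeasure \<mu> (c n))"
    using SUP_emeasure_incseq[of c \<mu>] c(1) by simp
  also have "\<dots> \<le> (SUP U\<in>\<U>. emeasure \<mu> U)"
    using c(2) by (intro SUP_mono) auto
  finally show "emeasure \<mu> (\<Union>\<U>) = (SUP U\<in>\<U>. emeasure \<mu> U)"
    using op b by (intro antisym SUP_least emeasure_mono) (auto intro: borel_open)
qed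

lemma mu_tilde_mono:
  fixes \<mu> :: "'a::second_countable_topology measure"
  assumes b: "sets \<mu> = sets borel" and h: "h \<in> lmaps" "h' \<in> lmaps" "h \<le> h'"
  shows "mu_tilde \<mu> h \<le> mu_tilde \<mu> h'"
proof -
  have le: "lo (h x) \<le> lo (h' x)" "hi (h' x) \<le> hi (h x)" for x
    using h(3) by (auto simp: le_fun_def ival_le_iff)
  then show ?thesis
    using mu_bounded_mono[of \<mu> "\<lambda>x. hi (h x)" "\<lambda>x. hi (h' x)"]
    by (auto simp: ival_le_iff lo_mu_tilde[OF b] hi_mu_tilde[OF b] h intro: nn_integral_mono)
qed

text \<open>Monotone convergence settles the lower ends. For the upper ends, decreasing convergence
  requires a finite integral at some stage: compactness provides an index from which the upper parts
  are mu-bounded, and the measure is bounded.\<close>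

lemma mu_tilde_chain:
  fixes \<mu> :: "'a::second_countable_topology measure"
  assumes b: "sets \<mu> = sets borel" and fin: "emeasure \<mu> (space \<mu>) < \<infinity>"
    and c: "incseq c" "\<And>n. c n \<in> lmaps" and s: "s \<in> lmaps"
    and lo: "\<And>x. lo (s x) = (SUP n. lo (c n x))" and hi: "\<And>x. hi (s x) = (INF n. hi (c n x))"
  shows "lo (mu_tilde \<mu> s) = (SUP n. lo (mu_tilde \<mu> (c n)))"
    and "hi (mu_tilde \<mu> s) = (INF n. hi (mu_tilde \<mu> (c n)))"
proof -
  have inc: "lo (c m x) \<le> lo (c n x)" "hi (c n x) \<le> hi (c m x)" if "m \<le> n" for m n x
    using c(1) that by (auto simp: incseq_def le_fun_def ival_le_iff)
  show "lo (mu_tilde \<mu> s) = (SUP n. lo (mu_tilde \<mu> (c n)))"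
    unfolding lo_mu_tilde[OF b s] lo_mu_tilde[OF b c(2)] lo
    using inc lmaps_lo_measurable[OF b c(2)]
    by (intro nn_integral_monotone_convergence_SUP) (auto simp: incseq_def le_fun_def)
  show "hi (mu_tilde \<mu> s) = (INF n. hi (mu_tilde \<mu> (c n)))"
  proof (rule antisym)
    have "c n \<le> s" for n
      unfolding le_fun_def ival_le_iff lo hi by (auto intro: SUP_upper INF_lower)
    then show "hi (mu_tilde \<mu> s) \<le> (INF n. hi (mu_tilde \<mu> (c n)))"
      using mu_tilde_mono[OF b c(2) s] by (auto simp: ival_le_iff intro: INF_greatest)
    show "(INF n. hi (mu_tilde \<mu> (c n))) \<le> hi (mu_tilde \<mu> s)"
    proof (cases "mu_bounded \<mu> (\<lambda>x. hi (s x))")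
      case False
      then show ?thesis by (simp add: hi_mu_tilde[OF b s])
    next
      case True
      then obtain Q where Q: "Q \<in> sets \<mu>" "compact Q" "saturated Q" "is_support \<mu> Q"
        "\<forall>x\<in>Q \<inter> supp \<mu>. hi (s x) < \<infinity>"
        unfolding mu_bounded_iff[OF b lmaps_hi_open[OF s]] by blast
      \<comment> \<open>A finite infimum means a finite value at some stage, so these open sets
        cover a compact set.\<close>
      have "Q \<inter> supp \<mu> \<subseteq> (\<Union>n\<in>UNIV. {x. hi (c n x) < \<infinity>})"
        using Q(5) by (auto simp: hi INF_less_iff)
      then obtain J where J: "finite J" "Q \<inter> supp \<mu> \<subseteq> (\<Union>n\<in>J. {x. hi (c n x) < \<infinity>})"
        using compactE_image[OF compact_Int_closed[OF Q(2) supp_is_support(1)[OF b]],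
            of UNIV "\<lambda>n. {x. hi (c n x) < \<infinity>}"] lmaps_hi_open[OF c(2)] by metis
      obtain N where N: "\<And>n. n \<in> J \<Longrightarrow> n \<le> N"
        using J(1) finite_nat_set_iff_bounded_le by auto
      have "hi (c N x) < \<infinity>" if "x \<in> Q \<inter> supp \<mu>" for x
        using J(2) that inc(2) N by (blast intro: le_less_trans)
      then have cN: "mu_bounded \<mu> (\<lambda>x. hi (c N x))"
        unfolding mu_bounded_iff[OF b lmaps_hi_open[OF c(2)]] using Q by blast
      have bd: "mu_bounded \<mu> (\<lambda>x. hi (c (n + N) x))" for n
        using cN inc(2)[of N "n + N"] by (rule mu_bounded_mono) simp
      \<comment> \<open>Dropping the first \<open>N\<close> terms leaves the infimum unchanged and
        makes all integrals finite.\<close>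
      have s_tail: "hi (s x) = (INF n. hi (c (n + N) x))" for x
        unfolding hi
      proof (rule INF_eq)
        show "\<exists>j\<in>UNIV. hi (c (j + N) x) \<le> hi (c n x)" for n
          using inc(2)[of n "n + N"] by auto
      qed auto
      have "(INF n. hi (mu_tilde \<mu> (c n))) \<le> (INF n. hi (mu_tilde \<mu> (c (n + N))))"
        by (rule INF_mono) auto
      also have "\<dots> = (INF n. \<integral>\<^sup>+ x. hi (c (n + N) x) \<partial>\<mu>)"
        by (simp add: hi_mu_tilde[OF b c(2)] bd)
      also have "\<dots> = (\<integral>\<^sup>+ x. (INF n. hi (c (n + N) x)) \<partial>\<mu>)"
        using inc(2) mu_bounded_integral_finite[OF b fin bd[of 0]] lmaps_hi_measurable[OF b c(2)]
        by (intro nn_integral_monotone_convergence_INF_decseq[symmetric, where i=0])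
          (auto simp: monotone_def le_fun_def)
      also have "\<dots> = hi (mu_tilde \<mu> s)"
        using True by (simp add: hi_mu_tilde[OF b s] s_tail[symmetric])
      finally show ?thesis .
    qed
  qed
qed

text \<open>The chain lies in \<open>D\<close>, so an upper bound of the image of \<open>D\<close>
  bounds the values along the chain, whose supremum is the value at \<open>s\<close>.\<close>

lemma mu_tilde_scott_continuous:
  fixes \<mu> :: "'a::second_countable_topology measure"
  assumes b: "sets \<mu> = sets borel" and fin: "emeasure \<mu> (space \<mu>) < \<infinity>"
  shows "scott_continuous_on lmaps (mu_tilde \<mu>)"
  unfolding scott_continuous_on_def
proof safe
  show m: "mono_on lmaps (mu_tilde \<mu>)"
    using mu_tilde_mono[OF b] by (auto simp: mono_on_def)
  fix D and s :: "'a \<Rightarrow> ival"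
  assume D: "D \<subseteq> lmaps" "directed_family D" and s: "is_sup_in lmaps D s"
  then have sl: "s \<in> lmaps" and ub: "\<And>d. d \<in> D \<Longrightarrow> d \<le> s"
    by (auto simp: is_sup_in_def)
  obtain c :: "nat \<Rightarrow> 'a \<Rightarrow> ival" where c: "incseq c" "range c \<subseteq> D"
    "\<And>x. lo (s x) = (SUP n. lo (c n x))" "\<And>x. hi (s x) = (INF n. hi (c n x))"
    by (rule directed_sup_is_chain_sup[OF D s], rule that)
  have cl: "c n \<in> lmaps" for n
    using c(2) D(1) by auto
  note ch = mu_tilde_chain[OF b fin c(1) cl sl c(3,4)]
  have le: "mu_tilde \<mu> d \<le> mu_tilde \<mu> s" if "d \<in> D" for d
    using mu_tilde_mono[OF b] that D(1) sl ub by blast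
  moreover have "mu_tilde \<mu> s \<le> u" if "\<forall>d\<in>mu_tilde \<mu> ` D. d \<le> u" for u
  proof -
    have "mu_tilde \<mu> (c n) \<le> u" for n
      using that c(2) by auto
    then show ?thesis
      by (auto simp: ival_le_iff ch intro: SUP_least INF_greatest)
  qed
  ultimately show "is_sup_in UNIV (mu_tilde \<mu> ` D) (mu_tilde \<mu> s)"
    by (auto simp: is_sup_in_def)
qed

text \<open>A mu-bounded function is finite almost everywhere, and for a finite scalar the two
  products then agree.\<close>

lemma nn_integral_times_r:
  fixes \<mu> :: "'a::second_countable_topology measure"
  assumes b: "sets \<mu> = sets borel" and f: "f \<in> borel_measurable \<mu>" "mu_bounded \<mu> f" and a: "a < \<infinity>"
  shows "(\<integral>\<^sup>+ x. times_r a (f x) \<partial>\<mu>) = a * (\<integral>\<^sup>+ x. f x \<partial>\<mu>)"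
proof -
  obtain M where M: "M < \<infinity>" "AE x in \<mu>. f x \<le> M"
    using mu_bounded_AE[OF b f(2)] .
  have "AE x in \<mu>. times_r a (f x) = a * f x"
    using M(2) by eventually_elim (use M(1) a in \<open>auto simp: times_r_def\<close>)
  then have "(\<integral>\<^sup>+ x. times_r a (f x) \<partial>\<mu>) = (\<integral>\<^sup>+ x. a * f x \<partial>\<mu>)"
    by (rule nn_integral_cong_AE)
  with f(1) show ?thesis
    by (simp add: nn_integral_cmult)
qed

text \<open>The upper product and the upper integral fit together: where the upper integral is
  \<open>\<infinity>\<close> for lack of mu-boundedness, even the scalar \<open>0\<close> keeps it
  so.\<close>

lemma mu_tilde_times:
  fixes \<mu> :: "'a::second_countable_topology measure"
  assumes b: "sets \<mu> = sets borel" and fin: "emeasure \<mu> (space \<mu>) < \<infinity>"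
    and nz: "emeasure \<mu> (space \<mu>) \<noteq> 0" and h: "h \<in> lmaps"
  shows "mu_tilde \<mu> (\<lambda>x. a * h x) = a * mu_tilde \<mu> h"
proof -
  note m = lmaps_lo_measurable[OF b h] lmaps_hi_measurable[OF b h]
  have le: "lo a * lo (h x) \<le> times_r (hi a) (hi (h x))" for x
    by (simp add: times_le_times_r lo_le_hi)
  have hm: "(\<lambda>x. times_r (hi a) (hi (h x))) \<in> borel_measurable \<mu>"
    unfolding times_r_def using m(2) by measurable
  have "lo (mu_tilde \<mu> (\<lambda>x. a * h x)) = (\<integral>\<^sup>+ x. lo a * lo (h x) \<partial>\<mu>)"
    using m(1) by (simp add: lo_mu_tilde_eq lo_times lower_integral_eq_nn_integral)
  also have "\<dots> = lo (a * mu_tilde \<mu> h)"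
    using m(1) by (simp add: nn_integral_cmult lo_times lo_mu_tilde[OF b h])
  finally have 1: "lo (mu_tilde \<mu> (\<lambda>x. a * h x)) = lo (a * mu_tilde \<mu> h)" .
  have "hi (mu_tilde \<mu> (\<lambda>x. a * h x)) = (if hi a < \<infinity> \<and> mu_bounded \<mu> (\<lambda>x. hi (h x))
      then (\<integral>\<^sup>+ x. times_r (hi a) (hi (h x)) \<partial>\<mu>) else \<infinity>)"
    using hm mu_bounded_times_r_iff[OF b nz lmaps_hi_open[OF h], of "hi a"]
    by (simp add: hi_mu_tilde_eq hi_times upper_integral_def lower_integral_eq_nn_integral)
  also have "\<dots> = times_r (hi a) (hi (mu_tilde \<mu> h))"
  \<comment> \<open>In the first case the integral is finite and the outer \<open>times_r\<close> is
    the ordinary product; in the second both sides are \<open>\<infinity>\<close>.\<close>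
  proof (cases "hi a < \<infinity> \<and> mu_bounded \<mu> (\<lambda>x. hi (h x))")
    case True
    then show ?thesis
      using nn_integral_times_r[OF b m(2), of "hi a"]
        mu_bounded_integral_finite[OF b fin, of "\<lambda>x. hi (h x)"]
      by (simp add: hi_mu_tilde[OF b h] times_r_def less_top)
  next
    case False
    then have "\<not> times_r (hi a) (hi (mu_tilde \<mu> h)) < \<infinity>"
      by (auto simp: hi_mu_tilde[OF b h] times_r_less_top_iff[simplified])
    with False show ?thesis by (auto simp: not_less top_unique)
  qed
  finally show ?thesis
    using 1 by (simp add: ival_eq_iff hi_times)
qed

text \<open>For the upper ends, the sum is mu-bounded exactly when both summands are, so the value
  \<open>\<infinity>\<close> occurs on both sides at once.\<close>

lemma mu_tilde_plus:
  fixes \<mu> :: "'a::second_countable_topology measure"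
  assumes coh: "coherent TYPE('a)" and b: "sets \<mu> = sets borel" and h: "h \<in> lmaps" "h' \<in> lmaps"
  shows "mu_tilde \<mu> (\<lambda>x. h x + h' x) = mu_tilde \<mu> h + mu_tilde \<mu> h'"
proof -
  note m = lmaps_lo_measurable[OF b h(1)] lmaps_hi_measurable[OF b h(1)]
    lmaps_lo_measurable[OF b h(2)] lmaps_hi_measurable[OF b h(2)]
  show ?thesis
    using m
    by (simp add: ival_eq_iff lo_plus hi_plus lo_mu_tilde[OF b] hi_mu_tilde[OF b] h)
      (simp add: lo_mu_tilde_eq hi_mu_tilde_eq lo_plus hi_plus upper_integral_def
        lower_integral_eq_nn_integral mu_bounded_add_iff[OF coh b] nn_integral_add)
qed

lemma mu_tilde_approximates:
  fixes \<mu> :: "'a::second_countable_topology measure"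
  assumes b: "sets \<mu> = sets borel"
  shows "approximates_measure (mu_tilde \<mu>) \<mu>"
  unfolding approximates_measure_def approximates_def
  by (auto simp: lo_mu_tilde[OF b] hi_mu_tilde[OF b] lower_integral_eq_nn_integral intro: nn_integral_mono)

section \<open>Saturations and the patch topology\<close>

text \<open>The up-closure of \<open>S\<close> in the specialization order. It has the same open
  neighbourhoods as \<open>S\<close>, hence inherits compactness.\<close>

definition saturation :: "'a::topological_space set \<Rightarrow> 'a set" where
  "saturation S = \<Inter>{U. open U \<and> S \<subseteq> U}"

lemma saturated_saturation: "saturated (saturation S)"
  unfolding saturated_def saturation_def by (rule exI[of _ "{U. open U \<and> S \<subseteq> U}"]) simp

lemma saturation_superset: "S \<subseteq> saturation S"
  unfolding saturation_def by blast

lemma saturation_subset_open: "open U \<Longrightarrow> S \<subseteq> U \<Longrightarrow> saturation S \<subseteq> U"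
  unfolding saturation_def by blast

lemma compact_saturation:
  assumes "compact S"
  shows "compact (saturation S)"
  unfolding compact_eq_Heine_Borel
proof safe
  fix \<C> assume C: "\<forall>c\<in>\<C>. open c" "saturation S \<subseteq> \<Union>\<C>"
  then have "S \<subseteq> \<Union>\<C>"
    using saturation_superset by blast
  then obtain C' where C': "C' \<subseteq> \<C>" "finite C'" "S \<subseteq> \<Union>C'"
    using assms C(1) by (metis compactE)
  have "saturation S \<subseteq> \<Union>C'"
    by (rule saturation_subset_open) (use C(1) C' in auto)
  with C' show "\<exists>C'\<subseteq>\<C>. finite C' \<and> saturation S \<subseteq> \<Union>C'" by blast
qed

text \<open>Finite unions of basic open sets form a countable neighbourhood base of a compact set;
  if the set is saturated, it is their intersection. This makes the saturation of \<open>K\<close>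
  an admissible witness in \<open>mu_bounded\<close>.\<close>

lemma compact_saturated_borel:
  fixes Q :: "'a::second_countable_topology set"
  assumes "compact Q" "saturated Q"
  shows "Q \<in> sets borel"
proof -
  obtain B :: "'a set set" where B: "countable B" "topological_basis B"
    using ex_countable_basis by blast
  define \<W> where "\<W> = {\<Union>F | F. F \<subseteq> B \<and> finite F \<and> Q \<subseteq> \<Union>F}"
  have "\<W> \<subseteq> Union ` {F. F \<subseteq> B \<and> finite F}"
    by (auto simp: \<W>_def)
  then have cW: "countable \<W>"
    using countable_Collect_finite_subset[OF B(1)]
    by (simp add: conj_commute countable_subset[OF _ countable_image])
  have oW: "open W" if "W \<in> \<W>" for W
    using that B(2) topological_basis_open by (fastforce simp: \<W>_def)
  have ex: "\<exists>W\<in>\<W>. W \<subseteq> U" if U: "open U" "Q \<subseteq> U" for U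
  proof -
    obtain B' where B': "B' \<subseteq> B" "\<Union>B' = U"
      using B(2) U(1) by (auto simp: topological_basis_def)
    have cov: "Q \<subseteq> \<Union>B'" and op: "\<And>b. b \<in> B' \<Longrightarrow> open b"
      using B' U(2) topological_basis_open[OF B(2)] by auto
    obtain F where F: "F \<subseteq> B'" "finite F" "Q \<subseteq> \<Union>F"
      by (rule compactE[OF assms(1) cov op])
    then have "\<Union>F \<in> \<W>"
      using B'(1) by (auto simp: \<W>_def)
    moreover have "\<Union>F \<subseteq> U"
      using F(1) B'(2) by blast
    ultimately show ?thesis by blast
  qed
  obtain \<U> where U: "\<forall>U\<in>\<U>. open U" "Q = \<Inter>\<U>"
    using assms(2) by (auto simp: saturated_def)
  have "Q = \<Inter>\<W>"
  proof
    show "Q \<subseteq> \<Inter>\<W>" by (auto simp: \<W>_def)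
    show "\<Inter>\<W> \<subseteq> Q"
      using U ex by (metis Inf_lower Inter_greatest order_trans)
  qed
  moreover have "\<W> \<noteq> {}"
    using ex[of UNIV] by auto
  ultimately show ?thesis
    using cW oW by (auto intro!: sets.countable_INT'[of \<W> "\<lambda>x. x", simplified])
qed

lemma patch_open: "open U \<Longrightarrow> openin patch_topology U"
  and patch_open_Compl: "compact Q \<Longrightarrow> saturated Q \<Longrightarrow> openin patch_topology (- Q)"
  unfolding patch_topology_def by (auto intro!: topology_generated_by_Basis)

text \<open>\<open>Q\<close> is patch-closed, so \<open>K \<inter> Q\<close> is patch-compact, and
  the given topology is coarser than the patch topology.\<close>

lemma patch_compact_Int_compact:
  assumes K: "compactin patch_topology K" and Q: "compact Q" "saturated Q"
  shows "compact (K \<inter> Q)"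
proof -
  have "closedin patch_topology Q"
    using patch_open_Compl[OF Q] patch_open[OF open_UNIV]
    by (metis Compl_eq_Diff_UNIV closedin_def double_complement openin_subset top.extremum_uniqueI subset_UNIV)
  then have KQ: "compactin patch_topology (K \<inter> Q)"
    using closed_Int_compactin K by (metis inf_commute)
  show ?thesis
    unfolding compact_eq_Heine_Borel
  proof safe
    fix \<C> :: "'a set set" assume "\<forall>c\<in>\<C>. open c" "K \<inter> Q \<subseteq> \<Union>\<C>"
    then show "\<exists>C'\<subseteq>\<C>. finite C' \<and> K \<inter> Q \<subseteq> \<Union>C'"
      using KQ patch_open unfolding compactin_def by (metis)
  qed
qed

lemma patch_compact_imp_compact:
  assumes "compactin patch_topology K"
  shows "compact K"
  unfolding compact_eq_Heine_Borel
  using assms patch_open unfolding compactin_def by metis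

text \<open>A compact topology has no strictly coarser Hausdorff topology, so the patch topology and
  the given topology agree on \<open>K\<close>.\<close>
lemma patch_compact_Hausdorff_separation:
  assumes "Hausdorff_space (top_of_set K)" "compactin patch_topology K"
    and "compact Q" "saturated Q" "k \<in> K" "k \<notin> Q"
  obtains U where "open U" "k \<in> U" "U \<inter> K \<inter> Q = {}"
proof -
  have "compactin (top_of_set K) (K \<inter> Q)"
    using patch_compact_Int_compact[OF assms(2-4)] by (simp add: compactin_subtopology)
  then have "closedin (top_of_set K) (K \<inter> Q)"
    using assms(1) compactin_imp_closedin by blast
  then have "openin (top_of_set K) (K - K \<inter> Q)"
    by (simp add: closedin_def)
  then obtain U where "open U" "K - K \<inter> Q = K \<inter> U"
    by (auto simp: openin_open)
  with that assms(5,6) show ?thesis by blast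
qed

section \<open>Maximality of \<open>mu_tilde \<mu>\<close>\<close>

text \<open>The complement of \<open>C\<close> is exhausted by a chain of open sets, each of which
  some neighbourhood of \<open>k\<close> avoids within \<open>K\<close>. Since \<open>k\<close> is
  in the support of \<open>\<mu>\<close>, what remains after removing such a set has positive
  measure.\<close>

lemma closed_Inter_of_positive_closed:
  fixes C K :: "'a::second_countable_topology set"
  assumes lc: "locally compact (UNIV :: 'a set)"
    and H: "Hausdorff_space (top_of_set K)" and P: "compactin patch_topology K"
    and b: "sets \<mu> = sets borel" and sK: "is_support \<mu> K"
    and C: "closed C" and k: "k \<in> K" "k \<in> supp \<mu>" "k \<in> C"
  obtains F :: "nat \<Rightarrow> 'a set" where "\<And>n. closed (F n)" "decseq F" "(\<Inter>n. F n) = C"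
    "\<And>n. emeasure \<mu> (F n) \<noteq> 0"
proof -
  \<comment> \<open>The removable sets: they are closed under finite unions, by intersecting the
    neighbourhoods \<open>U\<close> of \<open>k\<close>.\<close>
  define \<V> where "\<V> = {V. open V \<and> V \<subseteq> - C \<and> (\<exists>U. open U \<and> k \<in> U \<and> U \<inter> V \<inter> K = {})}"
  have dir: "directed_family \<V>"
  proof -
    have "V \<union> W \<in> \<V>" if VW: "V \<in> \<V>" "W \<in> \<V>" for V W
    proof -
      obtain U U' where U: "open U" "k \<in> U" "U \<inter> V \<inter> K = {}" "open U'" "k \<in> U'" "U' \<inter> W \<inter> K = {}"
        using VW by (auto simp: \<V>_def)
      have "open (U \<inter> U')" "k \<in> U \<inter> U'" "(U \<inter> U') \<inter> (V \<union> W) \<inter> K = {}"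
        using U by auto
      with VW show ?thesis
        unfolding \<V>_def by blast
    qed
    moreover have "{} \<in> \<V>"
      by (auto simp: \<V>_def)
    ultimately show ?thesis
      unfolding directed_family_def by (metis empty_iff sup_ge1 sup_ge2)
  qed
  have cover: "\<Union>\<V> = - C"
  proof
    show "\<Union>\<V> \<subseteq> - C" by (auto simp: \<V>_def)
    show "- C \<subseteq> \<Union>\<V>"
    proof
      fix y assume "y \<in> - C"
      \<comment> \<open>Local compactness gives a compact neighbourhood \<open>S\<close> of
        \<open>y\<close> off \<open>C\<close>. Its saturation stays in the open set
        \<open>- C\<close>, so it misses \<open>k\<close> and can be separated from \<open>k\<close>
        within \<open>K\<close>.\<close>
      then obtain V S where V: "open V" "compact S" "y \<in> V" "V \<subseteq> S" "S \<subseteq> - C"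
        using lc C unfolding locally_def by (metis open_Compl openin_subtopology_self open_openin subtopology_UNIV)
      have "saturation S \<subseteq> - C"
        using saturation_subset_open V(5) C by (metis open_Compl)
      then have "k \<notin> saturation S"
        using k(3) by blast
      then obtain U where "open U" "k \<in> U" "U \<inter> K \<inter> saturation S = {}"
        using patch_compact_Hausdorff_separation[OF H P compact_saturation[OF V(2)] saturated_saturation k(1)]
        by metis
      moreover have "V \<subseteq> saturation S"
        using V(4) saturation_superset by blast
      ultimately have "V \<in> \<V>"
        using V unfolding \<V>_def by blast
      with V(3) show "y \<in> \<Union>\<V>" by blast
    qed
  qed
  obtain E where E: "E \<subseteq> \<V>" "countable E" "\<Union>E = \<Union>\<V>"
    using Lindelof[of \<V>] by (auto simp: \<V>_def)
  obtain c where c: "incseq c" "range c \<subseteq> \<V>" "\<And>e. e \<in> E \<Longrightarrow> \<exists>n. e \<subseteq> c n"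
    using directed_countable_chain[OF dir E(1,2)] by metis
  have "(\<Union>n. c n) = - C"
  proof
    show "(\<Union>n. c n) \<subseteq> - C"
      using c(2) unfolding cover[symmetric] by blast
    show "- C \<subseteq> (\<Union>n. c n)"
      unfolding cover[symmetric] E(3)[symmetric] using c(3) by blast
  qed
  then have 1: "(\<Inter>n. - c n) = C" by blast
  have cV: "c n \<in> \<V>" for n
    using c(2) by blast
  have pos: "emeasure \<mu> (- c n) \<noteq> 0" for n
  proof -
    obtain U where U: "open U" "k \<in> U" "U \<inter> c n \<inter> K = {}" and o: "open (c n)"
      using cV[of n] by (auto simp: \<V>_def)
    \<comment> \<open>Equal traces on the support \<open>K\<close> give equal measures.\<close>
    have "U \<inter> K = (U - c n) \<inter> K"
      using U(3) by blast
    then have "emeasure \<mu> U = emeasure \<mu> (U - c n)"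
      using sK U(1) o b unfolding is_support_def by (metis borel_open sets.Diff)
    also have "\<dots> \<le> emeasure \<mu> (- c n)"
      using o b by (intro emeasure_mono) (auto simp: borel_comp)
    finally show ?thesis
      using supp_is_support(3)[OF b k(2) U(1,2)] by auto
  qed
  have cl: "closed (- c n)" for n
    using cV[of n] by (auto simp: \<V>_def)
  have dec: "decseq (\<lambda>n. - c n)"
    using c(1) by (auto simp: decseq_def incseq_def)
  show ?thesis
    by (rule that[of "\<lambda>n. - c n"]) (fact cl dec 1 pos)+
qed

lemma inverse_ennreal_antimono: "a \<le> b \<Longrightarrow> inverse b \<le> inverse (a :: ennreal)"
  unfolding less_eq_ennreal.rep_eq inverse_ennreal.rep_eq
  by (rule ereal_inverse_antimono) simp_all

lemma suminf_const_top:
  fixes a :: ennreal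
  assumes "a \<noteq> 0"
  shows "(\<Sum>n::nat. a) = \<infinity>"
proof -
  have "(\<Sum>n::nat. a) = (SUP n. of_nat n) * a"
    by (simp add: suminf_eq_SUP SUP_mult_right_ennreal)
  then show ?thesis
    using assms by (simp add: ennreal_SUP_of_nat_eq_top ennreal_top_mult)
qed

text \<open>The function \<open>\<Sum>n. indicator (F n) / \<mu> (F n)\<close> is finite outside the intersection of
  the \<open>F n\<close>, but each of its terms has integral \<open>1\<close>.\<close>
lemma usc_with_infinite_integral:
  fixes \<mu> :: "'a::topological_space measure" and F :: "nat \<Rightarrow> 'a set"
  assumes b: "sets \<mu> = sets borel" and fin: "emeasure \<mu> (space \<mu>) < \<infinity>"
    and F: "\<And>n. closed (F n)" "decseq F" "\<And>n. emeasure \<mu> (F n) \<noteq> 0"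
  obtains u :: "'a \<Rightarrow> ennreal" where "\<And>r. open {x. u x < r}"
    "\<And>x. u x = \<infinity> \<longleftrightarrow> x \<in> (\<Inter>n. F n)" "(\<integral>\<^sup>+ x. u x \<partial>\<mu>) = \<infinity>"
proof -
  define a where "a n = inverse (emeasure \<mu> (F n))" for n
  define u where "u x = (\<Sum>n. a n * indicator (F n) x)" for x
  have Fs: "F n \<in> sets \<mu>" for n
    using F(1) b by simp
  have le: "emeasure \<mu> (F n) \<le> emeasure \<mu> (space \<mu>)" for n
    by (rule emeasure_space)
  have fin': "emeasure \<mu> (F n) < \<infinity>" for n
    using le fin by (rule le_less_trans)
  have a_fin: "a n < \<infinity>" for n
    using F(3) by (simp add: a_def less_top[symmetric] ennreal_inverse_eq_top_iff)
  \<comment> \<open>Here \<open>m\<close> is the first index with \<open>x \<notin> F m\<close>. A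
    point \<open>y\<close> of the open set \<open>- F m\<close> lies only in sets \<open>F n\<close>
    with \<open>n < m\<close>, all of which contain \<open>x\<close>. So \<open>u\<close> has a
    local maximum at \<open>x\<close>, which gives upper semicontinuity.\<close>
  have local_le: "u y \<le> u x" if "x \<notin> F m" "y \<notin> F m" "\<And>n. n < m \<Longrightarrow> x \<in> F n" for x y m
    unfolding u_def
  proof (intro suminf_le mult_left_mono)
    fix n
    have "y \<in> F n \<Longrightarrow> n < m"
      using F(2) that(2) by (metis decseqD not_le subsetD)
    then show "indicator (F n) y \<le> (indicator (F n) x :: ennreal)"
      using that(3) by (auto simp: indicator_def)
  qed auto
  have out: "\<exists>m. x \<notin> F m \<and> (\<forall>n<m. x \<in> F n)" if "x \<notin> (\<Inter>n. F n)" for x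
    using that exists_least_iff[of "\<lambda>n. x \<notin> F n"] by auto
  have "u x = \<infinity>" if x: "x \<in> (\<Inter>n. F n)" for x
  proof -
    \<comment> \<open>On the intersection every term is at least the inverse of the total mass,
      which is positive because \<open>\<mu>\<close> is bounded.\<close>
    have "\<infinity> = (\<Sum>n::nat. inverse (emeasure \<mu> (space \<mu>)))"
      using fin by (simp add: suminf_const_top ennreal_inverse_eq_0_iff)
    also have "\<dots> \<le> u x"
      unfolding u_def a_def using x le
      by (intro suminf_le) (auto simp: inverse_ennreal_antimono)
    finally show ?thesis by (simp add: top_unique)
  qed
  moreover have "u x \<noteq> \<infinity>" if x: "x \<notin> (\<Inter>n. F n)" for x
  proof -
    obtain m where m: "x \<notin> F m" using x by auto
    have "u x = (\<Sum>n<m. a n * indicator (F n) x)"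
      unfolding u_def
    proof (rule suminf_finite)
      fix n assume "n \<notin> {..<m}"
      then have "F n \<subseteq> F m"
        using F(2) by (simp add: decseqD)
      then show "a n * indicator (F n) x = 0"
        using m by (auto simp: indicator_def)
    qed simp
    also have "\<dots> < \<infinity>"
      using a_fin by (auto simp: indicator_def)
    finally show ?thesis by simp
  qed
  ultimately have inf: "u x = \<infinity> \<longleftrightarrow> x \<in> (\<Inter>n. F n)" for x
    by blast
  have "open {x. u x < r}" for r
  proof (subst open_subopen, safe)
    fix x assume r: "u x < r"
    then have "x \<notin> (\<Inter>n. F n)"
      using inf by (metis infinity_ennreal_def not_top_less)
    then obtain m where m: "x \<notin> F m" "\<And>n. n < m \<Longrightarrow> x \<in> F n"
      using out by blast
    have "- F m \<subseteq> {x. u x < r}"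
      using local_le[OF m(1) _ m(2)] r by (auto intro: le_less_trans)
    then show "\<exists>T. open T \<and> x \<in> T \<and> T \<subseteq> {x. u x < r}"
      using F(1) m(1) by (intro exI[of _ "- F m"]) auto
  qed
  moreover have "(\<integral>\<^sup>+ x. u x \<partial>\<mu>) = \<infinity>"
  proof -
    have "(\<integral>\<^sup>+ x. u x \<partial>\<mu>) = (\<Sum>n. \<integral>\<^sup>+ x. a n * indicator (F n) x \<partial>\<mu>)"
      unfolding u_def using Fs by (intro nn_integral_suminf) auto
    also have "\<dots> = (\<Sum>n. a n * emeasure \<mu> (F n))"
      using Fs by (simp add: nn_integral_cmult_indicator)
    also have "\<dots> = (\<Sum>n. emeasure \<mu> (F n) / emeasure \<mu> (F n))"
      by (simp add: a_def divide_ennreal_def mult.commute)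
    also have "\<dots> = (\<Sum>n::nat. 1)"
      using F(3) fin' by (simp add: ennreal_divide_self)
    also have "\<dots> = \<infinity>"
      by (simp add: suminf_const_top)
    finally show ?thesis .
  qed
  ultimately show ?thesis
    using that inf by blast
qed

text \<open>The saturation of \<open>K\<close> contains a support, hence is one, and it is an
  admissible witness. If \<open>f\<close> were finite on \<open>K \<inter> supp \<mu>\<close>, it
  would be finite on \<open>saturation K \<inter> supp \<mu>\<close>, hence mu-bounded.\<close>

lemma not_mu_bounded_point:
  fixes \<mu> :: "'a::second_countable_topology measure"
  assumes b: "sets \<mu> = sets borel" and K: "compact K" "is_support \<mu> K"
    and f: "\<And>r. open {x. f x < r}" and nb: "\<not> mu_bounded \<mu> f"
  obtains k where "k \<in> K" "k \<in> supp \<mu>" "f k = \<infinity>"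
proof -
  let ?Q = "saturation K"
  have Q: "?Q \<in> sets \<mu>" "compact ?Q" "saturated ?Q"
    using b K(1) by (auto simp: compact_saturated_borel compact_saturation saturated_saturation)
  have "is_support \<mu> ?Q"
    unfolding is_support_def
  proof (intro conjI ballI impI)
    show "?Q \<subseteq> space \<mu>"
      by (simp add: space_borel_sets[OF b])
    fix A B assume "A \<in> sets \<mu>" "B \<in> sets \<mu>" "A \<inter> ?Q = B \<inter> ?Q"
    then show "emeasure \<mu> A = emeasure \<mu> B"
      using K(2) saturation_superset[of K] unfolding is_support_def by blast
  qed
  then have "\<exists>x\<in>?Q \<inter> supp \<mu>. \<not> f x < \<infinity>"
    using nb Q unfolding mu_bounded_iff[OF b f] by blast
  then have Q_not: "\<not> ?Q \<subseteq> - supp \<mu> \<union> {x. f x < \<infinity>}"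
    by blast
  \<comment> \<open>Finiteness on the support is phrased as inclusion in an open set, which
    \<open>K\<close> and its saturation satisfy together.\<close>
  have "open (- supp \<mu> \<union> {x. f x < \<infinity>})"
    using f supp_is_support(1)[OF b] by (intro open_Un) auto
  then have "\<not> K \<subseteq> - supp \<mu> \<union> {x. f x < \<infinity>}"
    using Q_not by (metis saturation_subset_open)
  then obtain x where x: "x \<in> K" "x \<in> supp \<mu>" "\<not> f x < \<infinity>"
    by blast
  then have "f x = \<infinity>"
    by (simp add: not_less top_unique)
  with x(1,2) that show ?thesis by simp
qed

lemma valuation_le_mu_tilde:
  fixes K :: "'a::second_countable_topology set" and \<mu> :: "'a measure"
  assumes lc: "locally compact (UNIV :: 'a set)"
    and H: "Hausdorff_space (top_of_set K)" and P: "compactin patch_topology K"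
    and b: "sets \<mu> = sets borel" and fin: "emeasure \<mu> (space \<mu>) < \<infinity>" and sK: "is_support \<mu> K"
    and \<nu>: "continuous_ival_valuation \<nu>" "approximates_measure \<nu> \<mu>" and h: "h \<in> lmaps"
  shows "\<nu> h \<le> mu_tilde \<mu> h"
proof -
  \<comment> \<open>Applied to the end point functions of \<open>h\<close> themselves, this gives
    both inequalities except the one for an upper part that is not mu-bounded.\<close>
  have ap: "lo (\<nu> g) \<le> (\<integral>\<^sup>+ x. f x \<partial>\<mu>)" "(\<integral>\<^sup>+ x. f x \<partial>\<mu>) \<le> hi (\<nu> g)"
    if f: "f \<in> borel_measurable \<mu>" and g: "g \<in> lmaps"
      and le: "\<And>x. lo (g x) \<le> f x \<and> f x \<le> hi (g x)" for f g
  proof -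
    have "approximates (\<nu> g) (lower_integral \<mu> f)"
      using \<nu>(2) f g le unfolding approximates_measure_def approximates_def by blast
    then show "lo (\<nu> g) \<le> (\<integral>\<^sup>+ x. f x \<partial>\<mu>)" "(\<integral>\<^sup>+ x. f x \<partial>\<mu>) \<le> hi (\<nu> g)"
      by (simp_all add: approximates_def lower_integral_eq_nn_integral[OF f])
  qed
  have zero: "\<nu> (\<lambda>x. 0 * g x) = 0 * \<nu> g" if "g \<in> lmaps" for g
    using \<nu>(1) that by (simp add: continuous_ival_valuation_def)
  have "hi (\<nu> h) = \<infinity>" if nb: "\<not> mu_bounded \<mu> (\<lambda>x. hi (h x))"
  proof -
    obtain k where k: "k \<in> K" "k \<in> supp \<mu>" "hi (h k) = \<infinity>"
      using not_mu_bounded_point[OF b patch_compact_imp_compact[OF P] sK lmaps_hi_open[OF h] nb] .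
    define C where "C = {x. hi (h x) = \<infinity>}"
    have "- C = {x. hi (h x) < \<infinity>}"
      by (auto simp: C_def less_top)
    then have "closed C"
      using lmaps_hi_open[OF h] by (simp add: closed_def)
    moreover have "k \<in> C"
      using k by (simp add: C_def)
    ultimately obtain F where F: "\<And>n. closed (F n)" "decseq F" "(\<Inter>n. F n) = C"
      "\<And>n. emeasure \<mu> (F n) \<noteq> 0"
      using closed_Inter_of_positive_closed[OF lc H P b sK _ k(1,2)] by metis
    obtain u where u: "\<And>r. open {x. u x < r}" "\<And>x. u x = \<infinity> \<longleftrightarrow> x \<in> C" "(\<integral>\<^sup>+ x. u x \<partial>\<mu>) = \<infinity>"
      using usc_with_infinite_integral[OF b fin F(1,2,4)] unfolding F(3) by metis
    define g where "g x = mk_ival 0 (u x)" for x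
    have g: "g \<in> lmaps"
      unfolding g_def using u(1) by (rule upper_map_in_lmaps)
    have hig: "hi (g x) = u x" and log: "lo (g x) = 0" for x
      by (simp_all add: g_def)
    have "u \<in> borel_measurable \<mu>"
      using lmaps_hi_measurable[OF b g] by (simp add: hig)
    then have g_top: "hi (\<nu> g) = \<infinity>"
      using ap(2)[of u g] g u(3) by (simp add: hig log top_unique)
    \<comment> \<open>Multiplication by \<open>0\<close> leaves upper end \<open>0\<close> or
      \<open>\<infinity>\<close>, recording only where the upper part is infinite; for
      \<open>g\<close> and for \<open>h\<close> this is \<open>C\<close>.\<close>
    have "0 * g x = 0 * h x" for x
      using u(2)[of x] by (simp add: ival_eq_iff lo_times hi_times lo_zero hi_zero hig times_r_def C_def)
    then have "0 * \<nu> h = 0 * \<nu> g"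
      using zero[OF g] zero[OF h] by simp
    \<comment> \<open>\<open>times_r 0 t\<close> is \<open>\<infinity>\<close> only for
      \<open>t = \<infinity>\<close>, so homogeneity transfers the infinite value from
      \<open>g\<close> to \<open>h\<close>.\<close>
    then have "times_r 0 (hi (\<nu> h)) = \<infinity>"
      using g_top by (simp add: ival_eq_iff hi_times hi_zero times_r_def)
    then show ?thesis
      by (simp add: times_r_def split: if_splits)
  qed
  moreover have "lo (\<nu> h) \<le> (\<integral>\<^sup>+ x. lo (h x) \<partial>\<mu>)"
    using ap(1)[OF lmaps_lo_measurable[OF b h] h] lo_le_hi by blast
  moreover have "(\<integral>\<^sup>+ x. hi (h x) \<partial>\<mu>) \<le> hi (\<nu> h)"
    using ap(2)[OF lmaps_hi_measurable[OF b h] h] lo_le_hi by blast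
  ultimately show ?thesis
    by (simp add: ival_le_iff lo_mu_tilde[OF b h] hi_mu_tilde[OF b h])
qed

theorem theorem8p8:
  fixes K :: "'a::second_countable_topology set"
    and \<mu> :: "'a measure"
  assumes "stably_compact TYPE('a)"
    and "Hausdorff_space (top_of_set K)"
    and "compactin patch_topology K"
    and "sets \<mu> = sets borel"
    and "emeasure \<mu> (space \<mu>) < \<infinity>"
    and "emeasure \<mu> (space \<mu>) \<noteq> 0"
    and "is_support \<mu> K"
  shows "tau_smooth \<mu> \<and>
    continuous_ival_valuation (mu_tilde \<mu>) \<and>
    approximates_measure (mu_tilde \<mu>) \<mu> \<and>
    (\<forall>\<nu>. continuous_ival_valuation \<nu> \<and> approximates_measure \<nu> \<mu> \<longrightarrow>
       (\<forall>h\<in>lmaps. \<nu> h \<le> mu_tilde \<mu> h))"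
proof -
  \<comment> \<open>Local compactness serves maximality, coherence serves additivity.\<close>
  have lc: "locally compact (UNIV :: 'a set)" and coh: "coherent TYPE('a)"
    using assms(1) by (auto simp: stably_compact_def)
  have "continuous_ival_valuation (mu_tilde \<mu>)"
    unfolding continuous_ival_valuation_def
    using mu_tilde_scott_continuous[OF assms(4,5)] mu_tilde_times[OF assms(4-6)]
      mu_tilde_plus[OF coh assms(4)] by blast
  then show ?thesis
    using tau_smooth_second_countable[OF assms(4)] mu_tilde_approximates[OF assms(4)]
      valuation_le_mu_tilde[OF lc assms(2-5,7)] by blast
qed

end
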